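(* There exists a holomorphic function $\phi$ from the open unit disk $\mathbb{D}$ onto $\mathbb{D}$ (that is, $\phi:\mathbb{D}\to\mathbb{D}$ is holomorphic with $\phi(\mathbb{D})=\mathbb{D}$), whose zero set $Z(\phi)=\{z\in\mathbb{D}:\phi(z)=0\}$ is a nonempty finite subset of $\mathbb{D}$, such that, for every $\lambda\in\mathbb{D}$, the inner part of $\phi-\phi(\lambda)$ is a finite Blaschke product if and only if $\lambda\in Z(\phi)$.
   Context: $\mathbb{D}=\{z\in\mathbb{C}:|z|<1\}$ and $H^\infty(\mathbb{D})$ is the set of bounded holomorphic functions on $\mathbb{D}$. Every $f\in H^\infty(\mathbb{D})$ that is not identically zero has a factorization $f=SF$, unique up to unimodular constants, with $S$ inner (a bounded holomorphic function on $\mathbb{D}$ whose radial boundary values have modulus $1$ almost everywhere on the unit circle) and $F$ outer; $S$ is called the inner part of $f$. A finite Blaschke product is a function of the form $c\prod_{j=1}^{n}\frac{a_j-z}{1-\overline{a_j}z}$ with $|c|=1$ and $a_1,\dots,a_n\in\mathbb{D}$. *)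

theory Defs
  imports "HOL-Complex_Analysis.Complex_Analysis"
begin

text \<open>Functions on the open unit disk are represented by total functions on the complex numbers;
  all conditions below only involve their values on \<^term>\<open>ball (0::complex) 1\<close>.\<close>

definition Hinf :: "(complex \<Rightarrow> complex) set" where
  "Hinf = {f. f holomorphic_on ball 0 1 \<and> bounded (f ` ball 0 1)}"

definition inner_function :: "(complex \<Rightarrow> complex) \<Rightarrow> bool" where
  "inner_function S \<longleftrightarrow> S \<in> Hinf \<and>
     (AE t\<in>{0..2*pi} in lborel.
        \<exists>w. norm w = 1 \<and> ((\<lambda>r. S (of_real r * cis t)) \<longlongrightarrow> w) (at_left 1))"

text \<open>The classical representation of an outer function with boundary modulus
  \<open>u(t) = |F(e\<^sup>i\<^sup>t)|\<close>, where \<open>u\<close> is positive, measurable, and \<open>log u\<close> is integrable.\<close>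

definition outer_function :: "(complex \<Rightarrow> complex) \<Rightarrow> bool" where
  "outer_function F \<longleftrightarrow>
     (\<exists>(c::complex) (u::real \<Rightarrow> real).
        norm c = 1 \<and>
        set_borel_measurable lborel {0..2*pi} u \<and>
        (\<forall>t\<in>{0..2*pi}. u t > 0) \<and>
        set_integrable lborel {0..2*pi} (\<lambda>t. ln (u t)) \<and>
        (\<forall>z\<in>ball 0 1.
           F z = c * exp (1 / (2 * of_real pi) *
             (LBINT t:{0..2*pi}. (cis t + z) / (cis t - z) * of_real (ln (u t))))))"

text \<open>The inner part is unique only up to a unimodular constant, so it is a relation rather than
  a function. The zero function has no inner part: outer functions have no zeros.\<close>

definition is_inner_part :: "(complex \<Rightarrow> complex) \<Rightarrow> (complex \<Rightarrow> complex) \<Rightarrow> bool" where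
  "is_inner_part S f \<longleftrightarrow> f \<in> Hinf \<and> inner_function S \<and>
     (\<exists>F. outer_function F \<and> (\<forall>z\<in>ball 0 1. f z = S z * F z))"

text \<open>The case \<open>n = 0\<close> (unimodular constants) is included.\<close>

definition finite_Blaschke_product :: "(complex \<Rightarrow> complex) \<Rightarrow> bool" where
  "finite_Blaschke_product B \<longleftrightarrow>
     (\<exists>(c::complex) (n::nat) (a::nat \<Rightarrow> complex).
        norm c = 1 \<and> (\<forall>j\<in>{1..n}. a j \<in> ball 0 1) \<and>
        (\<forall>z\<in>ball 0 1. B z = c * (\<Prod>j=1..n. (a j - z) / (1 - cnj (a j) * z))))"

end

theory Submission imports Defs begin

text \<open>The witness is \<open>\<phi> z = z * exp (- g z)\<close> with \<open>g z = (1 + \<i>) / csqrt (1 - z)\<close>. The map \<open>g\<close> is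
  conformal onto \<open>{x + \<i>y. x > 0, y > 0, 2xy > 1}\<close>, whose intersection with every vertical line in the
  right half-plane is unbounded. The singularity of \<open>g\<close> at \<open>1\<close> has order \<open>1/2\<close>, hence
  is integrable on the circle, and \<open>exp (- g)\<close> is outer; so the inner part of \<open>\<phi>\<close> is the
  identity. For \<open>0 < |w| < 1\<close> the equation \<open>\<phi> z = w\<close> reads
  \<open>\<zeta> = - Ln w + 2\<pi>n\<i> + Ln (1 - 2\<i> / \<zeta>\<^sup>2)\<close> in the coordinate \<open>\<zeta> = g z\<close>; the last term is small
  for large \<open>n\<close>, so Brouwer's theorem gives a solution for every large \<open>n\<close>. A function with
  infinitely many zeros has no finite Blaschke product as inner part.\<close>

section \<open>The Schwarz integral formula on the unit circle\<close>

lemma has_integral_circle_Cauchy: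
  fixes f :: "complex \<Rightarrow> complex"
  assumes "f holomorphic_on ball 0 R" "1 < R" "z \<in> ball 0 1"
  shows "((\<lambda>t. f (cis t) * cis t / (cis t - z)) has_integral 2 * pi * f z) {0..2*pi}"
proof -
  have "f holomorphic_on cball 0 1"
    by (rule holomorphic_on_subset[OF assms(1)]) (use assms(2) in auto)
  then have "((\<lambda>u. f u / (u - z)) has_contour_integral 2 * pi * \<i> * f z) (circlepath 0 1)"
    using Cauchy_integral_circlepath_simple[of f 0 1 z] assms(3) by simp
  then have "((\<lambda>t. f (cis t) / (cis t - z) * \<i> * cis t) has_integral 2 * pi * \<i> * f z) {0..2*pi}"
    using has_contour_integral_part_circlepath_iff[of 0 "2*pi" "\<lambda>u. f u / (u - z)" _ 0 1]
    by (simp add: circlepath_def)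
  from has_integral_mult_right[OF this, of "-\<i>"] show ?thesis
    by (simp add: algebra_simps)
qed

text \<open>On the unit circle \<open>cnj (cis t) = 1 / cis t\<close>, so the conjugate of the
  integrand is \<open>?h (cis t) * cis t\<close> with
  \<open>?h u = cnj z * f u / (1 - cnj z * u)\<close>. The zero of this denominator lies outside the
  closed disk, and Cauchy's theorem applies to \<open>?h\<close>.\<close>

lemma has_integral_circle_cnj_kernel:
  fixes f :: "complex \<Rightarrow> complex"
  assumes f: "f holomorphic_on ball 0 R" and R: "1 < R" and z: "z \<in> ball 0 1"
  shows "((\<lambda>t. cnj (f (cis t)) * z / (cis t - z)) has_integral 0) {0..2*pi}"
proof -
  have nz: "1 - cnj z * u \<noteq> 0" if "norm u \<le> 1" for u
  proof -
    have "norm (cnj z * u) < 1"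
      using that z mult_left_le[of "norm u" "norm z"] by (simp add: norm_mult)
    then show ?thesis by auto
  qed
  let ?h = "\<lambda>u. cnj z * f u / (1 - cnj z * u)"
  have fc: "f holomorphic_on cball 0 1"
    by (rule holomorphic_on_subset[OF f]) (use R in auto)
  have "?h holomorphic_on cball 0 1"
    by (intro holomorphic_intros fc) (use nz in auto)
  then have "(?h has_contour_integral 0) (circlepath 0 1)"
    by (intro Cauchy_theorem_convex_simple[of _ "cball 0 1"]) auto
  then have "((\<lambda>t. ?h (cis t) * \<i> * cis t) has_integral 0) {0..2*pi}"
    using has_contour_integral_part_circlepath_iff[of 0 "2*pi" ?h 0 0 1]
    by (simp add: circlepath_def)
  then have "((\<lambda>t. - \<i> * (?h (cis t) * \<i> * cis t)) has_integral - \<i> * 0) {0..2*pi}"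
    by (rule has_integral_mult_right)
  then have "(cnj \<circ> (\<lambda>t. - \<i> * (?h (cis t) * \<i> * cis t)) has_integral cnj 0) {0..2*pi}"
    unfolding has_integral_cnj by simp
  then have "((\<lambda>t. cnj (- \<i> * (?h (cis t) * \<i> * cis t))) has_integral 0) {0..2*pi}"
    by (simp add: o_def)
  moreover have "cnj (- \<i> * (?h (cis t) * \<i> * cis t)) = cnj (f (cis t)) * z / (cis t - z)" for t
  proof -
    have "cis t \<noteq> z" using z by auto
    moreover have "1 - z * cnj (cis t) \<noteq> 0"
      using nz[of "cis t"] by (metis complex_cnj_cnj complex_cnj_mult complex_cnj_one eq_iff_diff_eq_0 norm_cis order_refl)
    moreover have "cis t * cnj (cis t) = 1" by (simp add: cis_cnj cis_mult)
    ultimately show ?thesis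
      by (simp add: divide_simps) (simp add: algebra_simps)
  qed
  ultimately show ?thesis by simp
qed

text \<open>With \<open>e = cis t\<close>, the kernel \<open>(e + z) / (e - z)\<close> is both
  \<open>2 * e / (e - z) - 1\<close> and \<open>2 * z / (e - z) + 1\<close>. The first form is
  paired with \<open>f / 2\<close>, the second with \<open>cnj f / 2\<close>. The holomorphic part
  yields \<open>f z\<close> by Cauchy's formula, the conjugate part yields 0, and the two constant
  terms leave only \<open>Im (f 0)\<close>.\<close>

lemma Schwarz_formula:
  fixes f :: "complex \<Rightarrow> complex"
  assumes "f holomorphic_on ball 0 R" "1 < R" "z \<in> ball 0 1"
  shows "((\<lambda>t. (cis t + z) / (cis t - z) * of_real (Re (f (cis t))))
    has_integral 2 * pi * (f z - \<i> * Im (f 0))) {0..2*pi}"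
proof -
  have 1: "((\<lambda>t. f (cis t) * cis t / (cis t - z)) has_integral 2 * pi * f z) {0..2*pi}"
    by (rule has_integral_circle_Cauchy[OF assms])
  have 2: "((\<lambda>t. f (cis t)) has_integral 2 * pi * f 0) {0..2*pi}"
    using has_integral_circle_Cauchy[OF assms(1,2), of 0] by simp
  have 3: "((\<lambda>t. cnj (f (cis t))) has_integral cnj (2 * pi * f 0)) {0..2*pi}"
    using has_integral_cnj[of "\<lambda>t. f (cis t)" "2 * pi * f 0"] 2 by (simp only: o_def)
  have 4: "((\<lambda>t. cnj (f (cis t)) * z / (cis t - z)) has_integral 0) {0..2*pi}"
    by (rule has_integral_circle_cnj_kernel[OF assms])
  have "((\<lambda>t. f (cis t) * cis t / (cis t - z) - 1/2 * f (cis t) +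
      (cnj (f (cis t)) * z / (cis t - z) + 1/2 * cnj (f (cis t)))) has_integral
      2 * pi * f z - 1/2 * (2 * pi * f 0) + (0 + 1/2 * cnj (2 * pi * f 0))) {0..2*pi}"
    by (intro has_integral_add has_integral_diff has_integral_mult_right 1 2 3 4)
  moreover have "f (cis t) * cis t / (cis t - z) - 1/2 * f (cis t) +
      (cnj (f (cis t)) * z / (cis t - z) + 1/2 * cnj (f (cis t))) =
      (cis t + z) / (cis t - z) * of_real (Re (f (cis t)))" for t
  proof -
    have "cis t \<noteq> z" using assms(3) by auto
    moreover have "p * e / (e - z) - 1/2 * p + (q * z / (e - z) + 1/2 * q) = (e + z) / (e - z) * ((p + q) / 2)"
      if "e \<noteq> z" for p q e :: complex
      using that by (simp add: divide_simps) (simp add: algebra_simps)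
    moreover have "complex_of_real (Re (f (cis t))) = (f (cis t) + cnj (f (cis t))) / 2"
      by (simp add: complex_add_cnj)
    ultimately show ?thesis by (simp only: not_False_eq_True)
  qed
  moreover have "2 * pi * f z - 1/2 * (2 * pi * f 0) + (0 + 1/2 * cnj (2 * pi * f 0))
      = 2 * pi * (f z - \<i> * Im (f 0))"
    by (simp add: complex_eq_iff algebra_simps)
  ultimately show ?thesis by simp
qed

section \<open>A criterion for exponentials to be outer\<close>

text \<open>The Schwarz formula holds for the dilations of \<open>g\<close>, which are holomorphic
  across the circle. The majorant \<open>w\<close> is independent of the radius, so dominated
  convergence carries the formula over to \<open>g\<close> and its boundary values.\<close>

lemma outer_function_exp:
  fixes g :: "complex \<Rightarrow> complex" and w :: "real \<Rightarrow> real"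
  assumes hol: "g holomorphic_on ball 0 1"
    and cont: "continuous_on (cball 0 1 - {1}) g"
    and w: "set_integrable lborel {0<..<2*pi} w"
    and bound: "\<And>r t. \<lbrakk>0 < r; r < 1; 0 < t; t < 2*pi\<rbrakk> \<Longrightarrow> \<bar>Re (g (of_real r * cis t))\<bar> \<le> w t"
  shows "outer_function (\<lambda>z. exp (g z))"
proof -
  \<comment> \<open>The boundary values of \<open>Re g\<close>, set to 0 at the two parameters of
    the point 1, where \<open>g\<close> may be singular.\<close>
  define v where "v t = indicator {0<..<2*pi} t * Re (g (cis t))" for t
  \<comment> \<open>The double \<open>Suc\<close> keeps the radius positive at
    \<open>n = 0\<close>.\<close>
  define \<rho> where "\<rho> n = 1 - inverse (real (Suc (Suc n)))" for n
  have \<rho>: "0 < \<rho> n" "\<rho> n < 1" for n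
    by (auto simp: \<rho>_def field_simps)
  have \<rho>1: "\<rho> \<longlonglongrightarrow> 1"
    using tendsto_diff[OF tendsto_const LIMSEQ_Suc[OF LIMSEQ_inverse_real_of_nat], of 1]
    by (simp add: \<rho>_def[abs_def])
  have cis1: "cis t \<noteq> 1" if "0 < t" "t < 2*pi" for t
  proof
    assume "cis t = 1"
    then have "cos t = 1" by (simp add: complex_eq_iff)
    then obtain n :: int where "t = of_int n * 2 * pi"
      using cos_one_2pi_int by blast
    with that show False by (auto simp: zero_less_mult_iff mult_less_cancel_right)
  qed
  have AE: "AE t in lborel. t \<noteq> 0 \<and> t \<noteq> 2*pi"
    using AE_lborel_singleton[of 0] AE_lborel_singleton[of "2*pi"] by auto
  have vm: "v \<in> borel_measurable borel"
  proof -
    have "continuous_on {0<..<2*pi} (\<lambda>t. Re (g (cis t)))"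
      by (intro continuous_intros continuous_on_compose2[OF cont]) (use cis1 in auto)
    then have "(\<lambda>t. indicator {0<..<2*pi} t *\<^sub>R Re (g (cis t))) \<in> borel_measurable borel"
      by (intro borel_measurable_continuous_on_indicator) auto
    then show ?thesis by (simp add: v_def[abs_def])
  qed
  have lim: "(\<lambda>n. g (of_real (\<rho> n) * cis t)) \<longlonglongrightarrow> g (cis t)" if "0 < t" "t < 2*pi" for t
  proof (rule continuous_on_tendsto_compose[OF cont])
    show "(\<lambda>n. of_real (\<rho> n) * cis t) \<longlonglongrightarrow> cis t"
      using tendsto_mult[OF tendsto_of_real[OF \<rho>1] tendsto_const, of "cis t"] by simp
    show "cis t \<in> cball 0 1 - {1}" using cis1[OF that] by simp
    show "\<forall>\<^sub>F n in sequentially. of_real (\<rho> n) * cis t \<in> cball 0 1 - {1}"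
    proof (rule always_eventually, rule allI)
      fix n
      have "norm (of_real (\<rho> n) * cis t) < 1" using \<rho>[of n] by (simp add: norm_mult)
      then show "of_real (\<rho> n) * cis t \<in> cball 0 1 - {1}" by auto
    qed
  qed
  have vw: "\<bar>v t\<bar> \<le> w t" if "0 < t" "t < 2*pi" for t
  proof -
    have "(\<lambda>n. \<bar>Re (g (of_real (\<rho> n) * cis t))\<bar>) \<longlonglongrightarrow> \<bar>Re (g (cis t))\<bar>"
      by (intro tendsto_intros lim that)
    then have "\<bar>Re (g (cis t))\<bar> \<le> w t"
      by (rule LIMSEQ_le_const2) (use bound \<rho> that in auto)
    then show ?thesis using that by (simp add: v_def)
  qed
  have vint: "set_integrable lborel {0..2*pi} v"
  proof -
    have "norm (v t) \<le> norm (indicator {0<..<2*pi} t *\<^sub>R w t)" for t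
      using vw[of t] by (cases "t \<in> {0<..<2*pi}") (auto simp: v_def)
    then have "integrable lborel v"
      using vm by (intro Bochner_Integration.integrable_bound[OF w[unfolded set_integrable_def]]) auto
    then show ?thesis
      unfolding set_integrable_def by (intro integrable_mult_indicator) auto
  qed
  have Schwarz: "(LBINT t:{0..2*pi}. (cis t + z) / (cis t - z) * of_real (v t)) =
      2 * pi * (g z - \<i> * Im (g 0))" if z: "z \<in> ball 0 1" for z
  proof -
    define K where "K t = (cis t + z) / (cis t - z)" for t
    define s where "s n t = indicator {0..2*pi} t *\<^sub>R (K t * of_real (Re (g (of_real (\<rho> n) * cis t))))" for n t
    have cz: "cis t \<noteq> z" for t using z by auto
    have contK: "continuous_on UNIV K"
      unfolding K_def by (intro continuous_intros) (use cz in auto)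
    have Kb: "norm (K t) \<le> 2 / (1 - norm z)" for t
    proof -
      have "norm (cis t + z) \<le> 2" using norm_triangle_ineq[of "cis t" z] z by simp
      moreover have "1 - norm z \<le> norm (cis t - z)" using norm_triangle_ineq2[of "cis t" z] by simp
      ultimately show ?thesis unfolding K_def norm_divide
        using z by (intro frac_le) auto
    qed
    have contn: "continuous_on {0..2*pi} (\<lambda>t. K t * of_real (Re (g (of_real (\<rho> n) * cis t))))" for n
    proof (intro continuous_intros continuous_on_subset[OF contK]
        continuous_on_compose2[OF holomorphic_on_imp_continuous_on[OF hol]])
      show "(\<lambda>t. of_real (\<rho> n) * cis t) ` {0..2*pi} \<subseteq> ball 0 1"
        using \<rho>[of n] by (auto simp: norm_mult)
    qed auto
    have sn: "(\<integral>t. s n t \<partial>lborel) = 2 * pi * (g (of_real (\<rho> n) * z) - \<i> * Im (g 0))" for n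
    proof -
      \<comment> \<open>Dilation enlarges the disk to a radius above 1, as
        \<open>Schwarz_formula\<close> requires.\<close>
      have "(\<lambda>z. g (of_real (\<rho> n) * z)) holomorphic_on ball 0 (1 / \<rho> n)"
        by (rule holomorphic_on_compose_gen[OF _ hol, unfolded o_def])
          (use \<rho>[of n] in \<open>auto intro!: holomorphic_intros simp: norm_mult field_simps\<close>)
      from Schwarz_formula[OF this _ z] \<rho>[of n]
      have "((\<lambda>t. K t * of_real (Re (g (of_real (\<rho> n) * cis t)))) has_integral
         2 * pi * (g (of_real (\<rho> n) * z) - \<i> * Im (g 0))) {0..2*pi}"
        by (simp add: K_def)
      with set_borel_integral_eq_integral(2)[OF borel_integrable_atLeastAtMost'[OF contn[of n]]]
      show ?thesis
        by (simp add: s_def set_lebesgue_integral_def integral_unique)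
    qed
    \<comment> \<open>The kernel is bounded by \<open>2 / (1 - norm z)\<close> for fixed
      \<open>z\<close>, so this constant times \<open>w\<close> dominates every
      \<open>s n\<close>.\<close>
    have "(\<lambda>n. \<integral>t. s n t \<partial>lborel) \<longlonglongrightarrow> (\<integral>t. indicator {0..2*pi} t *\<^sub>R (K t * of_real (v t)) \<partial>lborel)"
    proof (rule integral_dominated_convergence)
      have Km: "K \<in> borel_measurable borel"
        by (rule borel_measurable_continuous_onI[OF contK])
      show "(\<lambda>t. indicator {0..2*pi} t *\<^sub>R (K t * of_real (v t))) \<in> borel_measurable lborel"
        using Km vm by measurable
      show "s n \<in> borel_measurable lborel" for n
        using borel_integrable_atLeastAtMost'[OF contn[of n]]
        unfolding s_def[abs_def] set_integrable_def by (rule borel_measurable_integrable)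
      show "integrable lborel (\<lambda>t. 2 / (1 - norm z) * (indicator {0<..<2*pi} t *\<^sub>R w t))"
        using w unfolding set_integrable_def by (rule integrable_mult_right)
      show "AE t in lborel. (\<lambda>n. s n t) \<longlonglongrightarrow> indicator {0..2*pi} t *\<^sub>R (K t * of_real (v t))"
        using AE
      proof eventually_elim
        case (elim t)
        show ?case
        proof (cases "0 < t \<and> t < 2*pi")
          case True
          then show ?thesis unfolding s_def v_def
            by (auto intro!: tendsto_intros lim)
        next
          case False
          then have "t \<notin> {0..2*pi}" using elim by auto
          then show ?thesis by (simp add: s_def)
        qed
      qed
      show "AE t in lborel. norm (s n t) \<le> 2 / (1 - norm z) * (indicator {0<..<2*pi} t *\<^sub>R w t)" for n
        using AE
      proof eventually_elim
        case (elim t)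
        show ?case
        proof (cases "0 < t \<and> t < 2*pi")
          case True
          then have "norm (s n t) = norm (K t) * \<bar>Re (g (of_real (\<rho> n) * cis t))\<bar>"
            by (simp add: s_def norm_mult)
          also have "\<dots> \<le> 2 / (1 - norm z) * w t"
            using True z by (intro mult_mono Kb bound \<rho>) auto
          finally show ?thesis using True by simp
        next
          case False
          then have "t \<notin> {0..2*pi}" "t \<notin> {0<..<2*pi}" using elim by auto
          then show ?thesis by (simp add: s_def)
        qed
      qed
    qed
    moreover have "(\<lambda>n. \<integral>t. s n t \<partial>lborel) \<longlonglongrightarrow> 2 * pi * (g z - \<i> * Im (g 0))"
    proof -
      have "(\<lambda>n. g (of_real (\<rho> n) * z)) \<longlonglongrightarrow> g z"
      proof (rule continuous_on_tendsto_compose[OF holomorphic_on_imp_continuous_on[OF hol]])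
        show "(\<lambda>n. of_real (\<rho> n) * z) \<longlonglongrightarrow> z"
          using tendsto_mult[OF tendsto_of_real[OF \<rho>1] tendsto_const, of z] by simp
        have "norm (of_real (\<rho> n) * z) < 1" for n
          using \<rho>[of n] z mult_left_le_one_le[of "norm z" "\<rho> n"]
          by (simp add: norm_mult)
        then show "\<forall>\<^sub>F n in sequentially. of_real (\<rho> n) * z \<in> ball 0 1" by simp
      qed (use z in auto)
      then show ?thesis unfolding sn by (intro tendsto_intros)
    qed
    ultimately show ?thesis
      using LIMSEQ_unique unfolding set_lebesgue_integral_def K_def by blast
  qed
  show ?thesis
    unfolding outer_function_def
  \<comment> \<open>The boundary modulus is \<open>exp (v t)\<close>. The Schwarz integral misses
    \<open>\<i> * Im (g 0)\<close>, which the unimodular constant restores.\<close>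
  proof (intro exI[of _ "cis (Im (g 0))"] exI[of _ "\<lambda>t. exp (v t)"] conjI ballI)
    show "set_borel_measurable lborel {0..2*pi} (\<lambda>t. exp (v t))"
      unfolding set_borel_measurable_def using vm by measurable
    show "set_integrable lborel {0..2*pi} (\<lambda>t. ln (exp (v t)))"
      using vint by simp
    fix z :: complex assume z: "z \<in> ball 0 1"
    show "exp (g z) = cis (Im (g 0)) * exp (1 / (2 * of_real pi) *
       (LBINT t:{0..2*pi}. (cis t + z) / (cis t - z) * of_real (ln (exp (v t)))))"
      unfolding ln_exp Schwarz[OF z] by (simp add: cis_conv_exp flip: exp_add)
  qed auto
qed

section \<open>An integrable majorant near the boundary point 1\<close>

text \<open>From \<open>y * cos y \<le> sin y\<close> at \<open>y = x / 2\<close> and the double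
  angle formula, \<open>sin x \<ge> x * cos (x/2) ^ 2\<close>; moreover
  \<open>2 * cos (x/2) ^ 2 = 1 + cos x \<ge> 1\<close> in this range.\<close>

lemma sin_ge_half_self:
  assumes "0 \<le> x" "x \<le> pi / 2"
  shows "x / 2 \<le> sin x"
proof -
  have d: "x * cos x \<le> sin x" if "0 \<le> x" "x \<le> pi" for x :: real
  proof -
    have "(\<lambda>x. sin x - x * cos x) 0 \<le> (\<lambda>x. sin x - x * cos x) x"
    proof (rule DERIV_nonneg_imp_nondecreasing[OF that(1)])
      fix y assume "0 \<le> y" "y \<le> x"
      then have "0 \<le> y * sin y" using that by (simp add: sin_ge_zero)
      moreover have "((\<lambda>x. sin x - x * cos x) has_real_derivative y * sin y) (at y)"
        by (auto intro!: derivative_eq_intros)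
      ultimately show "\<exists>d. ((\<lambda>x. sin x - x * cos x) has_real_derivative d) (at y) \<and> 0 \<le> d" by blast
    qed
    then show ?thesis by simp
  qed
  have "x / 2 * 1 \<le> x / 2 * (2 * cos (x/2) ^ 2)"
  proof (rule mult_left_mono)
    have "0 \<le> cos x" using assms by (intro cos_ge_zero) auto
    then show "1 \<le> 2 * cos (x/2) ^ 2" using cos_double_cos[of "x/2"] by simp
  qed (use assms in simp)
  also have "\<dots> = 2 * (x/2 * cos (x/2)) * cos (x/2)" by (simp add: power2_eq_square)
  also have "\<dots> \<le> 2 * sin (x/2) * cos (x/2)"
    using d[of "x/2"] assms by (intro mult_right_mono cos_ge_zero) auto
  also have "\<dots> = sin x" using sin_double[of "x/2"] by simp
  finally show ?thesis by simp
qed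

text \<open>The chord from 1 to \<open>cis t\<close> has length \<open>2 * sin (t/2)\<close>; for
  \<open>t > pi\<close> the sine bound is applied to the reflected angle.\<close>

lemma norm_one_minus_cis_ge:
  assumes "0 \<le> t" "t \<le> 2 * pi"
  shows "min t (2 * pi - t) / 2 \<le> norm (1 - cis t)"
proof -
  have "norm (1 - cis t) ^ 2 = (2 * sin (t/2)) ^ 2"
    unfolding cmod_power2 using cos_double_sin[of "t/2"] sin_cos_squared_add[of t]
    by (simp add: power2_eq_square algebra_simps)
  then have n: "norm (1 - cis t) = 2 * sin (t/2)"
    using assms by (intro power2_eq_imp_eq[of _ "2 * sin (t/2)"]) (auto intro: sin_ge_zero)
  show ?thesis
  proof (cases "t \<le> pi")
    case True
    then show ?thesis using sin_ge_half_self[of "t/2"] assms n by simp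
  next
    case False
    have "sin (pi - t/2) = sin (t/2)" by simp
    then show ?thesis using sin_ge_half_self[of "pi - t/2"] False assms n by simp
  qed
qed

text \<open>Moving from \<open>cis t\<close> radially to \<open>r * cis t\<close> costs
  \<open>1 - r\<close>, itself at most the distance from \<open>r * cis t\<close> to 1. This makes
  the later bound uniform in \<open>r\<close>.\<close>

lemma norm_one_minus_cis_le:
  assumes "0 < r" "r < 1"
  shows "norm (1 - cis t) \<le> 2 * norm (1 - of_real r * cis t)"
proof -
  have "norm (of_real r * cis t - cis t) = \<bar>r - 1\<bar>"
    by (metis left_diff_distrib' mult.right_neutral norm_cis norm_mult norm_of_real of_real_1 of_real_diff mult_1)
  moreover have "1 - r \<le> norm (1 - of_real r * cis t)"
    using norm_triangle_ineq2[of 1 "of_real r * cis t"] assms by (simp add: norm_mult)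
  moreover have "norm (1 - cis t) \<le> norm (1 - of_real r * cis t) + norm (of_real r * cis t - cis t)"
    using norm_triangle_ineq[of "1 - of_real r * cis t" "of_real r * cis t - cis t"] by simp
  ultimately show ?thesis using assms by simp
qed

text \<open>The nonnegative function \<open>1 / sqrt t + 1 / sqrt (a - t)\<close> has the primitive
  \<open>?F\<close>, which has finite limits at both ends.\<close>

lemma set_integrable_inverse_sqrt_endpoints:
  "set_integrable lborel {0<..<a::real} (\<lambda>t. c * (1 / sqrt t + 1 / sqrt (a - t)))"
proof (cases "0 < a")
  case True
  let ?F = "\<lambda>t. 2 * sqrt t - 2 * sqrt (a - t)"
  have "set_integrable lborel (einterval (ereal 0) (ereal a)) (\<lambda>t. 1 / sqrt t + 1 / sqrt (a - t))"
  proof (rule interval_integral_FTC_nonneg(1)[where F = ?F and A = "?F 0" and B = "?F a"])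
    fix x assume "ereal 0 < ereal x" "ereal x < ereal a"
    then have x: "0 < x" "x < a" by auto
    show "(?F has_real_derivative (1 / sqrt x + 1 / sqrt (a - x))) (at x)"
      using x by (auto intro!: derivative_eq_intros simp: field_simps)
    show "isCont (\<lambda>t. 1 / sqrt t + 1 / sqrt (a - t)) x"
      using x by (intro continuous_intros) auto
  next
    show "((?F \<circ> real_of_ereal) \<longlongrightarrow> ?F 0) (at_right (ereal 0))"
      unfolding ereal_tendsto_simps by (intro tendsto_intros)
    show "((?F \<circ> real_of_ereal) \<longlongrightarrow> ?F a) (at_left (ereal a))"
      unfolding ereal_tendsto_simps by (intro tendsto_intros)
  qed (use True in auto)
  then show ?thesis by (simp add: einterval_def greaterThanLessThan_def greaterThan_def lessThan_def Collect_conj_eq)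
qed (simp add: set_integrable_def)

section \<open>The conformal map with a singularity of order 1/2\<close>

text \<open>On the disk \<open>1 / csqrt (1 - z)\<close> has argument strictly between
  \<open>-pi/4\<close> and \<open>pi/4\<close>; the factor \<open>1 + \<i>\<close> turns this sector
  into the first quadrant, where the imaginary part can grow while the real part stays
  bounded.\<close>

definition rotated_root :: "complex \<Rightarrow> complex" where
  "rotated_root z = (1 + \<i>) / csqrt (1 - z)"

text \<open>Keeps \<open>1 - z\<close> off the branch cut of \<open>csqrt\<close>, up to the
  boundary except at 1.\<close>

lemma one_minus_notin_nonpos_Reals:
  fixes z :: complex
  assumes "norm z \<le> 1" "z \<noteq> 1"
  shows "1 - z \<notin> \<real>\<^sub>\<le>\<^sub>0"
proof
  assume "1 - z \<in> \<real>\<^sub>\<le>\<^sub>0"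
  then have "1 \<le> Re z" "Im z = 0" by (auto simp: complex_nonpos_Reals_iff)
  moreover have "Re z \<le> 1" using assms complex_Re_le_cmod[of z] by simp
  ultimately have "z = 1" by (simp add: complex_eq_iff)
  with assms show False by simp
qed

lemma csqrt_one_minus_nonzero:
  assumes "z \<noteq> 1"
  shows "csqrt (1 - z) \<noteq> 0"
  using assms by simp

lemma holomorphic_rotated_root: "rotated_root holomorphic_on ball 0 1"
proof -
  have z: "norm z \<le> 1 \<and> z \<noteq> 1" if "z \<in> ball (0::complex) 1" for z
    using that by auto
  have "csqrt holomorphic_on - \<real>\<^sub>\<le>\<^sub>0"
    by (intro holomorphic_intros) auto
  then have "(csqrt \<circ> (\<lambda>z. 1 - z)) holomorphic_on ball 0 1"
    by (intro holomorphic_on_compose_gen[of _ _ _ "- \<real>\<^sub>\<le>\<^sub>0"] holomorphic_intros)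
      (use z one_minus_notin_nonpos_Reals in blast)+
  then show ?thesis
    unfolding rotated_root_def[abs_def] o_def
    by (intro holomorphic_on_divide holomorphic_on_const) (use z csqrt_one_minus_nonzero in blast)+
qed

lemma continuous_on_rotated_root: "continuous_on (cball 0 1 - {1}) rotated_root"
proof -
  have z: "norm z \<le> 1 \<and> z \<noteq> 1" if "z \<in> cball (0::complex) 1 - {1}" for z
    using that by auto
  have "continuous_on (- \<real>\<^sub>\<le>\<^sub>0) csqrt"
    by (rule continuous_on_csqrt)
  then have "continuous_on (cball 0 1 - {1}) (\<lambda>z. csqrt (1 - z))"
    by (rule continuous_on_compose2) (intro continuous_intros, use z one_minus_notin_nonpos_Reals in blast)
  then show ?thesis
    unfolding rotated_root_def[abs_def]
    by (intro continuous_on_divide continuous_on_const) (use z csqrt_one_minus_nonzero in blast)+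
qed

text \<open>For \<open>s = csqrt (1 - z)\<close>, \<open>Re (s ^ 2) > 0\<close> forces
  \<open>\<bar>Im s\<bar> < Re s\<close>, and the real part of \<open>(1 + \<i>) / s\<close> has the
  sign of \<open>Re s + Im s\<close>.\<close>

lemma Re_rotated_root_pos:
  assumes "z \<in> ball 0 1"
  shows "0 < Re (rotated_root z)"
proof -
  define s where "s = csqrt (1 - z)"
  have "0 < Re (1 - z)" using assms complex_Re_le_cmod[of z] by simp
  moreover have "s ^ 2 = 1 - z" by (simp add: s_def)
  ultimately have "0 < Re s ^ 2 - Im s ^ 2" by (simp only: flip: Re_power2)
  moreover have "0 \<le> Re s" unfolding s_def by (rule Re_csqrt)
  ultimately have "\<bar>Im s\<bar> < Re s" by (simp add: power2_less_imp_less)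
  then have "0 < Re s + Im s" "Re s \<noteq> 0" by linarith+
  moreover from this(2) have "0 < Re s ^ 2 + Im s ^ 2" by (simp add: sum_power2_gt_zero_iff)
  moreover have "Re ((1 + \<i>) / s) = (Re s + Im s) / (Re s ^ 2 + Im s ^ 2)"
    by (simp add: Re_divide)
  ultimately show ?thesis unfolding rotated_root_def s_def[symmetric]
    by (simp only: divide_pos_pos)
qed

lemma norm_rotated_root_le:
  assumes "0 < r" "r < 1" "0 < t" "t < 2 * pi"
  shows "norm (rotated_root (of_real r * cis t)) \<le> 4 * (1 / sqrt t + 1 / sqrt (2 * pi - t))"
proof -
  \<comment> \<open>The distance of \<open>t\<close> to the nearer endpoint; the two chord estimates
    bound the distance to 1 below by \<open>m / 4\<close>.\<close>
  define m where "m = min t (2 * pi - t)"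
  have m: "0 < m" using assms by (simp add: m_def)
  have "m / 4 \<le> norm (1 - of_real r * cis t)"
    using norm_one_minus_cis_ge[of t] norm_one_minus_cis_le[OF assms(1,2), of t] assms
    unfolding m_def by linarith
  then have 1: "sqrt (m / 4) \<le> norm (csqrt (1 - of_real r * cis t))"
    by simp
  have "norm (1 + \<i>) \<le> 2" using norm_triangle_ineq[of 1 \<i>] by simp
  then have "norm (rotated_root (of_real r * cis t)) \<le> 2 / sqrt (m / 4)"
    unfolding rotated_root_def norm_divide using 1 m by (intro frac_le) auto
  also have "\<dots> = 4 * (1 / sqrt m)" by (simp add: real_sqrt_divide)
  also have "\<dots> \<le> 4 * (1 / sqrt t + 1 / sqrt (2 * pi - t))"
    using assms by (auto simp: m_def min_def)
  finally show ?thesis .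
qed

text \<open>Solving \<open>\<zeta>^2 = 2 * \<i> / (1 - z)\<close> for \<open>z\<close> gives the
  inverse map. Then \<open>norm z < 1\<close> means
  \<open>norm (\<zeta>^2 - 2 * \<i>) < norm (\<zeta>^2)\<close>, that is
  \<open>Im (\<zeta>^2) > 1\<close>; the signs of \<open>Re \<zeta>\<close> and
  \<open>Im \<zeta>\<close> select the principal root.\<close>

lemma rotated_root_inverse:
  assumes "0 < Re \<zeta>" "0 < Im \<zeta>" "1 < 2 * Re \<zeta> * Im \<zeta>"
  defines "z \<equiv> 1 - 2 * \<i> / \<zeta> ^ 2"
  shows "z \<in> ball 0 1" "rotated_root z = \<zeta>"
proof -
  have nz: "\<zeta> \<noteq> 0" using assms by auto
  have "norm (\<zeta>^2 - 2 * \<i>) ^ 2 < norm (\<zeta>^2) ^ 2"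
    unfolding cmod_power2 using assms by (simp add: Im_power2 power2_eq_square algebra_simps)
  then have "norm (\<zeta>^2 - 2 * \<i>) < norm (\<zeta>^2)" by (rule power2_less_imp_less) simp
  moreover have "z = (\<zeta>^2 - 2 * \<i>) / \<zeta>^2" using nz by (simp add: z_def field_simps)
  ultimately show "z \<in> ball 0 1" using nz by (simp add: norm_divide)
  have "csqrt (1 - z) = (1 + \<i>) / \<zeta>"
  proof (rule csqrt_unique)
    show "((1 + \<i>) / \<zeta>)\<^sup>2 = 1 - z"
      by (simp add: z_def power_divide power2_eq_square algebra_simps)
    have "0 < Re ((1 + \<i>) / \<zeta>)"
      using assms by (simp add: Re_divide divide_pos_pos add_pos_pos)
    then show "0 < Re ((1 + \<i>) / \<zeta>) \<or> Re ((1 + \<i>) / \<zeta>) = 0 \<and> 0 \<le> Im ((1 + \<i>) / \<zeta>)" by simp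
  qed
  moreover have "(1 + \<i>) \<noteq> 0" by (simp add: complex_eq_iff)
  ultimately show "rotated_root z = \<zeta>" using nz by (simp add: rotated_root_def)
qed

section \<open>Solving \<open>z * exp (- rotated_root z) = w\<close> by Brouwer's theorem\<close>

lemma exists_preimage_large_rotated_root:
  fixes w :: complex and M :: real
  assumes "w \<noteq> 0" "norm w < 1"
  obtains z where "z \<in> ball 0 1" "z * exp (- rotated_root z) = w" "M < norm (rotated_root z)"
proof -
  define a where "a = - ln (norm w)"
  have a: "0 < a" using assms by (simp add: a_def)
  have "((\<lambda>\<zeta>::complex. Ln (1 - 2 * \<i> / \<zeta> ^ 2)) \<longlongrightarrow> Ln (1 - 0)) at_infinity"
    by (intro tendsto_intros tendsto_divide_0 filterlim_power_at_infinity filterlim_ident) auto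
  then have "\<forall>\<^sub>F \<zeta> in at_infinity. norm (Ln (1 - 2 * \<i> / \<zeta> ^ 2)) < a / 2"
    using a by (auto simp: tendsto_iff dist_norm dest: spec[of _ "a/2"])
  then obtain N where N: "\<And>\<zeta>. N \<le> norm \<zeta> \<Longrightarrow> norm (Ln (1 - 2 * \<i> / \<zeta> ^ 2)) < a / 2"
    by (auto simp: eventually_at_infinity)
  \<comment> \<open>A lower bound for \<open>Im \<zeta>\<close>: \<open>\<bar>N\<bar>\<close> gives
    the logarithm estimate, \<open>\<bar>M\<bar>\<close> the required size, 2 makes
    \<open>2 * \<i> / \<zeta>^2\<close> smaller than 1 in modulus, and \<open>2 / a\<close> gives
    \<open>2 * Re \<zeta> * Im \<zeta> > 1\<close>.\<close>
  define L where "L = \<bar>N\<bar> + \<bar>M\<bar> + 2 + 2 / a"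
  obtain n :: nat where n: "L + a / 2 + \<bar>Im (Ln w)\<bar> < 2 * pi * real n"
    using reals_Archimedean3[of "2 * pi"] by (metis mult.commute pi_gt_zero zero_less_mult_iff zero_less_numeral)
  define c where "c = - Ln w + 2 * pi * real n * \<i>"
  have Re_c: "Re c = a" using assms by (simp add: c_def a_def)
  have Im_c: "L + a / 2 < Im c" using n by (simp add: c_def)
  \<comment> \<open>As \<open>Re c = a\<close>, a disk of radius \<open>a / 2\<close> about
    \<open>c\<close> stays away from the imaginary axis; \<open>n\<close> was chosen to lift all of
    it above height \<open>L\<close>.\<close>
  have est: "a / 2 \<le> Re \<zeta>" "L \<le> Im \<zeta>" "L \<le> norm \<zeta>" if "\<zeta> \<in> cball c (a / 2)" for \<zeta>
  proof -
    have "norm (c - \<zeta>) \<le> a / 2" using that by (simp add: dist_norm)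
    then have "\<bar>Re (c - \<zeta>)\<bar> \<le> a / 2" "\<bar>Im (c - \<zeta>)\<bar> \<le> a / 2"
      using abs_Re_le_cmod[of "c - \<zeta>"] abs_Im_le_cmod[of "c - \<zeta>"] by auto
    then show *: "a / 2 \<le> Re \<zeta>" "L \<le> Im \<zeta>"
      using Re_c Im_c unfolding minus_complex.simps by linarith+
    show "L \<le> norm \<zeta>" using *(2) abs_Im_le_cmod[of \<zeta>] by linarith
  qed
  have "0 < 2 / a" using a by simp
  then have L: "2 \<le> L" "2 / a < L" "N \<le> L" "M < L" unfolding L_def by linarith+
  \<comment> \<open>Makes the logarithm continuous on the disk and later shows
    \<open>z \<noteq> 0\<close>.\<close>
  have pos: "0 < Re (1 - 2 * \<i> / \<zeta> ^ 2)" if "\<zeta> \<in> cball c (a / 2)" for \<zeta>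
  proof -
    have "2 \<le> norm \<zeta>" using est(3)[OF that] L by linarith
    then have "2^2 \<le> norm \<zeta> ^ 2" by (intro power_mono) auto
    then have "norm (2 * \<i> / \<zeta> ^ 2) < 1"
      by (subst norm_divide) (simp add: norm_power divide_simps norm_mult)
    then show ?thesis using complex_Re_le_cmod[of "2 * \<i> / \<zeta> ^ 2"] by (simp del: Re_divide_numeral)
  qed
  obtain \<zeta> where \<zeta>: "\<zeta> \<in> cball c (a / 2)" "c + Ln (1 - 2 * \<i> / \<zeta> ^ 2) = \<zeta>"
  proof (rule brouwer_ball[of "a/2" c "\<lambda>\<zeta>. c + Ln (1 - 2 * \<i> / \<zeta> ^ 2)"])
    show "continuous_on (cball c (a / 2)) (\<lambda>\<zeta>. c + Ln (1 - 2 * \<i> / \<zeta> ^ 2))"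
    proof -
      have "\<zeta> ^ 2 \<noteq> 0" if "\<zeta> \<in> cball c (a / 2)" for \<zeta>
        using est(3)[OF that] L(1) by auto
      moreover have "1 - 2 * \<i> / \<zeta> ^ 2 \<notin> \<real>\<^sub>\<le>\<^sub>0" if "\<zeta> \<in> cball c (a / 2)" for \<zeta>
        using pos[OF that] unfolding complex_nonpos_Reals_iff by linarith
      ultimately show ?thesis
        by (intro continuous_on_add continuous_on_const continuous_on_Ln' continuous_on_diff
            continuous_on_divide continuous_on_power continuous_on_id) blast+
    qed
    show "(\<lambda>\<zeta>. c + Ln (1 - 2 * \<i> / \<zeta> ^ 2)) \<in> cball c (a / 2) \<rightarrow> cball c (a / 2)"
    proof (rule Pi_I)
      fix \<zeta> assume *: "\<zeta> \<in> cball c (a / 2)"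
      have "N \<le> norm \<zeta>" using est(3)[OF *] L by linarith
      from N[OF this] show "c + Ln (1 - 2 * \<i> / \<zeta> ^ 2) \<in> cball c (a / 2)"
        by (simp add: dist_norm)
    qed
  qed (use a in auto)
  define z where "z = 1 - 2 * \<i> / \<zeta> ^ 2"
  note e = est[OF \<zeta>(1)]
  have "1 = 2 * (a / 2) * (1 / a)" using a by simp
  also have "\<dots> < 2 * (a / 2) * L" using a L(1,2)
    by (intro mult_strict_left_mono) (auto simp: field_simps)
  also have "\<dots> \<le> 2 * Re \<zeta> * Im \<zeta>" using e L a by (intro mult_mono) auto
  finally have "1 < 2 * Re \<zeta> * Im \<zeta>" .
  moreover have "0 < Re \<zeta>" "0 < Im \<zeta>" using e L a by linarith+
  ultimately have z: "z \<in> ball 0 1" "rotated_root z = \<zeta>"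
    unfolding z_def by (blast intro: rotated_root_inverse)+
  have z0: "z \<noteq> 0" using pos[OF \<zeta>(1)] by (auto simp: z_def)
  show thesis
  proof (rule that[OF z(1)])
    \<comment> \<open>The fixed point equation reads \<open>\<zeta> = c + Ln z\<close>.\<close>
    have "exp (- rotated_root z) = exp (- c - Ln z)"
      using \<zeta>(2) by (simp add: z(2) flip: z_def) (metis minus_add_distrib diff_conv_add_uminus)
    also have "\<dots> = exp (- c) / z" using z0 by (simp add: exp_diff)
    also have "exp (- c) = w"
    proof -
      have "exp (2 * pi * real n * \<i>) = exp (2 * of_real pi * \<i>) ^ n"
        by (simp add: mult_ac flip: exp_of_nat_mult)
      then have "exp (2 * pi * real n * \<i>) = 1" by simp
      moreover have "- c = Ln w - 2 * pi * real n * \<i>" by (simp add: c_def)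
      ultimately show ?thesis using assms(1) by (simp only: exp_diff exp_Ln div_by_1 simp_thms)
    qed
    finally show "z * exp (- rotated_root z) = w" using z0 by simp
    show "M < norm (rotated_root z)" using e(3) L(4) z(2) by simp
  qed
qed

section \<open>Inner parts and the number of zeros\<close>

lemma outer_function_exp_minus_rotated_root: "outer_function (\<lambda>z. exp (- rotated_root z))"
proof (rule outer_function_exp)
  show "(\<lambda>z. - rotated_root z) holomorphic_on ball 0 1"
    by (intro holomorphic_intros holomorphic_rotated_root)
  show "continuous_on (cball 0 1 - {1}) (\<lambda>z. - rotated_root z)"
    by (intro continuous_intros continuous_on_rotated_root)
  show "set_integrable lborel {0<..<2*pi} (\<lambda>t. 4 * (1 / sqrt t + 1 / sqrt (2*pi - t)))"
    by (rule set_integrable_inverse_sqrt_endpoints)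
  show "\<bar>Re (- rotated_root (of_real r * cis t))\<bar> \<le> 4 * (1 / sqrt t + 1 / sqrt (2*pi - t))"
    if "0 < r" "r < 1" "0 < t" "t < 2*pi" for r t
    using norm_rotated_root_le[OF that] abs_Re_le_cmod[of "rotated_root (of_real r * cis t)"] by simp
qed

lemma inner_function_ident: "inner_function (\<lambda>z. z)"
  unfolding inner_function_def
proof
  show "(\<lambda>z. z) \<in> Hinf"
    by (simp add: Hinf_def holomorphic_on_ident)
  have "((\<lambda>r. of_real r * cis t) \<longlongrightarrow> of_real 1 * cis t) (at_left 1)" for t
    by (intro tendsto_intros)
  then show "AE t\<in>{0..2*pi} in lborel.
      \<exists>w. norm w = 1 \<and> ((\<lambda>r. of_real r * cis t) \<longlongrightarrow> w) (at_left 1)"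
    by (intro AE_I2) (metis norm_cis mult_1 of_real_1)
qed

lemma finite_Blaschke_product_ident: "finite_Blaschke_product (\<lambda>z. z)"
  unfolding finite_Blaschke_product_def
  \<comment> \<open>The Blaschke factor with zero 0 is \<open>- z\<close>, hence the constant
    \<open>-1\<close>.\<close>
  by (rule exI[of _ "-1"], rule exI[of _ 1], rule exI[of _ "\<lambda>_. 0"]) simp

text \<open>An outer function is a unimodular constant times an exponential and so never vanishes;
  all zeros of \<open>f\<close> in the disk are zeros of its inner part, found among the
  \<open>a j\<close>.\<close>

lemma finite_zeros_if_finite_Blaschke_inner_part:
  assumes S: "is_inner_part S f" and B: "finite_Blaschke_product S"
  shows "finite {z \<in> ball 0 1. f z = 0}"
proof -
  obtain F where F: "outer_function F" "\<And>z. z \<in> ball 0 1 \<Longrightarrow> f z = S z * F z"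
    using S unfolding is_inner_part_def by blast
  have F0: "F z \<noteq> 0" if "z \<in> ball 0 1" for z
  proof -
    obtain d :: complex and u where d: "norm d = 1"
      and u: "\<forall>z\<in>ball 0 1. F z = d * exp (1 / (2 * of_real pi) *
             (LBINT t:{0..2*pi}. (cis t + z) / (cis t - z) * of_real (ln (u t))))"
      using F(1) unfolding outer_function_def by blast
    have "d \<noteq> 0" using d by auto
    then show ?thesis unfolding bspec[OF u that] by simp
  qed
  obtain c and n :: nat and a where c: "norm c = 1" and a: "\<forall>j\<in>{1..n}. a j \<in> ball 0 1"
    and eq: "\<forall>z\<in>ball 0 1. S z = c * (\<Prod>j=1..n. (a j - z) / (1 - cnj (a j) * z))"
    using B unfolding finite_Blaschke_product_def by blast
  have "z \<in> a ` {1..n}" if z: "z \<in> ball 0 1" "f z = 0" for z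
  proof -
    have "S z = 0" using F(2)[OF z(1)] F0[OF z(1)] z(2) by simp
    then have "c * (\<Prod>j=1..n. (a j - z) / (1 - cnj (a j) * z)) = 0"
      using bspec[OF eq z(1)] by (simp only:)
    moreover have "c \<noteq> 0" using c by auto
    ultimately have "(\<Prod>j=1..n. (a j - z) / (1 - cnj (a j) * z)) = 0"
      by (simp only: mult_eq_0_iff simp_thms)
    then obtain j where j: "j \<in> {1..n}" "(a j - z) / (1 - cnj (a j) * z) = 0"
      unfolding prod_zero_iff[OF finite_atLeastAtMost] by blast
    \<comment> \<open>A quotient is also 0 when its denominator is 0, so that case has to be
      excluded.\<close>
    have "norm (cnj (a j) * z) < 1"
      using bspec[OF a j(1)] z(1) mult_strict_mono'[of "norm (a j)" 1 "norm z" 1] by (simp add: norm_mult)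
    then have "cnj (a j) * z \<noteq> 1" by (metis less_irrefl norm_one)
    then have "a j = z" using j(2) by simp
    then show ?thesis using j(1) by blast
  qed
  then have "{z \<in> ball 0 1. f z = 0} \<subseteq> a ` {1..n}" by blast
  then show ?thesis by (rule finite_subset) simp
qed

lemma infinite_preimages:
  assumes "w \<noteq> 0" "norm w < 1"
  shows "infinite {z \<in> ball 0 1. z * exp (- rotated_root z) = w}"
proof
  assume fin: "finite {z \<in> ball 0 1. z * exp (- rotated_root z) = w}" (is "finite ?A")
  \<comment> \<open>A finite fibre would bound \<open>norm (rotated_root z)\<close>, against the
    existence of solutions beyond any bound. Inserting 0 keeps \<open>Max\<close> meaningful if
    \<open>?A\<close> is empty.\<close>
  obtain z where "z \<in> ?A" "Max (insert 0 ((norm \<circ> rotated_root) ` ?A)) < norm (rotated_root z)"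
    using exists_preimage_large_rotated_root[OF assms, of "Max (insert 0 ((norm \<circ> rotated_root) ` ?A))"]
    by blast
  moreover from this(1) have "norm (rotated_root z) \<le> Max (insert 0 ((norm \<circ> rotated_root) ` ?A))"
    using fin by (intro Max_ge) auto
  ultimately show False by simp
qed

theorem corollary2p3:
  "\<exists>\<phi>::complex \<Rightarrow> complex.
     \<phi> holomorphic_on ball 0 1 \<and>
     \<phi> ` ball 0 1 = ball 0 1 \<and>
     {z \<in> ball 0 1. \<phi> z = 0} \<noteq> {} \<and>
     finite {z \<in> ball 0 1. \<phi> z = 0} \<and>
     (\<forall>l\<in>ball 0 1.
        (\<exists>S. is_inner_part S (\<lambda>z. \<phi> z - \<phi> l) \<and> finite_Blaschke_product S) \<longleftrightarrow>
        l \<in> {z \<in> ball 0 1. \<phi> z = 0})"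
proof -
  define \<phi> where "\<phi> z = z * exp (- rotated_root z)" for z
  have hol: "\<phi> holomorphic_on ball 0 1"
    unfolding \<phi>_def[abs_def] by (intro holomorphic_intros holomorphic_rotated_root)
  have zeros: "{z \<in> ball 0 1. \<phi> z = 0} = {0}"
    by (auto simp: \<phi>_def)
  have lt1: "norm (\<phi> z) < 1" if "z \<in> ball 0 1" for z
  proof -
    have "norm z * exp (- Re (rotated_root z)) \<le> norm z * 1"
      using Re_rotated_root_pos[OF that] by (intro mult_left_mono) auto
    then show ?thesis using that by (simp add: \<phi>_def norm_mult)
  qed
  have inf: "infinite {z \<in> ball 0 1. \<phi> z = w}" if "w \<noteq> 0" "norm w < 1" for w
    unfolding \<phi>_def by (rule infinite_preimages[OF that])
  have onto: "\<phi> ` ball 0 1 = ball 0 1"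
  proof
    show "\<phi> ` ball 0 1 \<subseteq> ball 0 1" using lt1 by auto
    show "ball 0 1 \<subseteq> \<phi> ` ball 0 1"
    proof
      fix w :: complex assume w: "w \<in> ball 0 1"
      show "w \<in> \<phi> ` ball 0 1"
      proof (cases "w = 0")
        case True
        then show ?thesis using zeros by force
      next
        case False
        then have "{z \<in> ball 0 1. \<phi> z = w} \<noteq> {}" using inf[of w] w by (metis finite.emptyI mem_ball_0)
        then show ?thesis by blast
      qed
    qed
  qed
  have Hinf: "\<phi> \<in> Hinf"
    using hol onto by (simp add: Hinf_def)
  have "(\<exists>S. is_inner_part S (\<lambda>z. \<phi> z - \<phi> l) \<and> finite_Blaschke_product S) \<longleftrightarrow> \<phi> l = 0"
    if l: "l \<in> ball 0 1" for l
  proof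
    assume "\<phi> l = 0"
    \<comment> \<open>With \<open>\<phi> l = 0\<close> the defining product of \<open>\<phi>\<close>
      is already its inner-outer factorization.\<close>
    then have "is_inner_part (\<lambda>z. z) (\<lambda>z. \<phi> z - \<phi> l)"
      using Hinf inner_function_ident outer_function_exp_minus_rotated_root
      by (auto simp: is_inner_part_def \<phi>_def[abs_def])
    then show "\<exists>S. is_inner_part S (\<lambda>z. \<phi> z - \<phi> l) \<and> finite_Blaschke_product S"
      using finite_Blaschke_product_ident by blast
  next
    assume "\<exists>S. is_inner_part S (\<lambda>z. \<phi> z - \<phi> l) \<and> finite_Blaschke_product S"
    then have "finite {z \<in> ball 0 1. \<phi> z - \<phi> l = 0}"
      using finite_zeros_if_finite_Blaschke_inner_part by blast
    \<comment> \<open>Every nonzero value in the disk is taken infinitely often by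
      \<open>\<phi>\<close>.\<close>
    then show "\<phi> l = 0"
      using inf[of "\<phi> l"] lt1[OF l] by auto
  qed
  then show ?thesis
    using hol onto zeros by (intro exI[of _ \<phi>]) auto
qed

end
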